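(* Let $G$ be a connected graph of order $n$ and size $m$. Then \[LE_\varepsilon(G)\le\sqrt{nE_1(G)-\zeta(G)^2+2mn}.\]
   Context: $G$ is simple with vertices $v_1,\dots,v_n$. $\varepsilon_G(v)=\max_{u} d_G(u,v)$ is the eccentricity ($d_G$ = shortest-path distance); $\zeta(G)=\sum_i\varepsilon_G(v_i)$; $E_1(G)=\sum_i\varepsilon_G(v_i)^2$. $\mu'_1,\dots,\mu'_n$ are the eigenvalues of $L_\varepsilon(G)=\varepsilon(G)-A(G)$, where $A(G)$ is the adjacency matrix and $\varepsilon(G)$ the diagonal matrix with entries $\varepsilon_G(v_i)$. $LE_\varepsilon(G)=\sum_{i=1}^n|\mu'_i-\zeta(G)/n|$. *)

theory Defs
  imports
    "Graph_Theory.Digraph_Component"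
    "Graph_Theory.Shortest_Path"
    "Jordan_Normal_Form.Char_Poly"
    "HOL-Computational_Algebra.Computational_Algebra"
begin

text \<open>
  A finite simple graph is an element of the locale \<^locale>\<open>graph\<close>: each edge between \<open>u\<close> and \<open>v\<close>
  is represented by the two arcs \<open>u \<rightarrow> v\<close> and \<open>v \<rightarrow> u\<close>. Hence the size of \<open>G\<close> is the number of
  unordered pairs below, not the number of arcs.
\<close>
definition undirected_edges :: "('a, 'b) pre_digraph \<Rightarrow> 'a set set" where
  "undirected_edges G = (\<lambda>e. {tail G e, head G e}) ` arcs G"

definition distance :: "('a, 'b) pre_digraph \<Rightarrow> 'a \<Rightarrow> 'a \<Rightarrow> ereal" where
  "distance G u v = wf_digraph.\<mu> G (\<lambda>_. 1) u v"

text \<open>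
  In a connected graph all distances are finite, so the conversion to \<^typ>\<open>real\<close> is lossless there.
\<close>
definition eccentricity :: "('a, 'b) pre_digraph \<Rightarrow> 'a \<Rightarrow> real" where
  "eccentricity G v = real_of_ereal (MAX u\<in>verts G. distance G u v)"

definition total_eccentricity :: "('a, 'b) pre_digraph \<Rightarrow> real" where
  "total_eccentricity G = (\<Sum>v\<in>verts G. eccentricity G v)"

definition first_zagreb_eccentricity :: "('a, 'b) pre_digraph \<Rightarrow> real" where
  "first_zagreb_eccentricity G = (\<Sum>v\<in>verts G. (eccentricity G v)\<^sup>2)"

text \<open>
  The matrices depend on an enumeration \<open>v 0, \<dots>, v (n - 1)\<close> of the \<open>n\<close> vertices of \<open>G\<close>.
\<close>
definition adjacency_mat :: "('a, 'b) pre_digraph \<Rightarrow> (nat \<Rightarrow> 'a) \<Rightarrow> real mat" where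
  "adjacency_mat G v =
     (let n = card (verts G) in mat n n (\<lambda>(i, j). if v i \<rightarrow>\<^bsub>G\<^esub> v j then 1 else 0))"

definition eccentricity_diag_mat :: "('a, 'b) pre_digraph \<Rightarrow> (nat \<Rightarrow> 'a) \<Rightarrow> real mat" where
  "eccentricity_diag_mat G v =
     (let n = card (verts G) in mat n n (\<lambda>(i, j). if i = j then eccentricity G (v i) else 0))"

definition eccentricity_laplacian :: "('a, 'b) pre_digraph \<Rightarrow> (nat \<Rightarrow> 'a) \<Rightarrow> real mat" where
  "eccentricity_laplacian G v = eccentricity_diag_mat G v - adjacency_mat G v"

text \<open>
  Eigenvalues are counted with algebraic multiplicity. They are taken in \<^typ>\<open>complex\<close>, so that
  an \<open>n \<times> n\<close> matrix always has exactly \<open>n\<close> of them; for a symmetric real matrix all of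
  them are real.
\<close>
definition eigenvalues_mset :: "real mat \<Rightarrow> complex multiset" where
  "eigenvalues_mset A = proots (char_poly (map_mat complex_of_real A))"

definition eccentricity_laplacian_energy :: "('a, 'b) pre_digraph \<Rightarrow> (nat \<Rightarrow> 'a) \<Rightarrow> real" where
  "eccentricity_laplacian_energy G v =
     (\<Sum>\<mu>\<in>#eigenvalues_mset (eccentricity_laplacian G v).
        cmod (\<mu> - complex_of_real (total_eccentricity G / real (card (verts G)))))"

end

theory Submission
  imports Defs "Jordan_Normal_Form.Schur_Decomposition" "HOL-Analysis.Convex"
begin

text \<open>
  The matrix \<open>L = \<epsilon>(G) - A(G)\<close> is real symmetric, so its eigenvalues \<open>\<mu>\<^sub>i\<close> are real, with
  \<open>\<Sum> \<mu>\<^sub>i = tr L = \<zeta>\<close> and \<open>\<Sum> \<mu>\<^sub>i\<^sup>2 = tr L\<^sup>2 = E\<^sub>1 + 2m\<close>. Cauchy-Schwarz gives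
  \<open>(\<Sum> \<bar>\<mu>\<^sub>i - \<zeta>/n\<bar>)\<^sup>2 \<le> n \<Sum> (\<mu>\<^sub>i - \<zeta>/n)\<^sup>2 = n (E\<^sub>1 + 2m) - \<zeta>\<^sup>2\<close>.
\<close>

definition mat_trace :: "'a :: comm_semiring_0 mat \<Rightarrow> 'a" where
  "mat_trace A = (\<Sum>i<dim_row A. A $$ (i, i))"

lemma mat_trace_mult:
  assumes "A \<in> carrier_mat n k" "B \<in> carrier_mat k n"
  shows "mat_trace (A * B) = (\<Sum>i<n. \<Sum>j<k. A $$ (i, j) * B $$ (j, i))"
  using assms unfolding mat_trace_def
  by (auto simp: scalar_prod_def atLeast0LessThan intro!: sum.cong)

lemma mat_trace_mult_commute:
  assumes "A \<in> carrier_mat n k" "B \<in> carrier_mat k n"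
  shows "mat_trace (A * B) = mat_trace (B * A)"
  unfolding mat_trace_mult[OF assms] mat_trace_mult[OF assms(2,1)]
  by (subst sum.swap) (simp add: mult.commute)

text \<open>Cyclicity of the trace moves \<open>Q\<close> in front of \<open>P * B\<close>, where
  \<open>Q * P\<close> cancels.\<close>

lemma mat_trace_similar:
  fixes A B :: "'a :: comm_semiring_1 mat"
  assumes "similar_mat A B"
  shows "mat_trace A = mat_trace B"
proof -
  from similar_matD[OF assms] obtain n P Q where
    carr: "A \<in> carrier_mat n n" "B \<in> carrier_mat n n" "P \<in> carrier_mat n n" "Q \<in> carrier_mat n n"
    and QP: "Q * P = 1\<^sub>m n" and A: "A = P * B * Q" by auto
  have "mat_trace A = mat_trace (Q * (P * B))"
    unfolding A using carr by (intro mat_trace_mult_commute) auto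
  also have "Q * (P * B) = Q * P * B"
    using carr by (simp add: assoc_mult_mat[of _ n n _ n _ n])
  finally show ?thesis using carr QP by simp
qed

text \<open>The same \<open>P\<close> and \<open>Q\<close> serve for the squares, because the inner
  \<open>Q * P\<close> cancels. This carries the second power sum of the eigenvalues over to a
  triangular form.\<close>

lemma similar_mat_square:
  fixes A B :: "'a :: comm_semiring_1 mat"
  assumes "similar_mat A B"
  shows "similar_mat (A * A) (B * B)"
proof -
  from similar_matD[OF assms] obtain n P Q where
    carr: "A \<in> carrier_mat n n" "B \<in> carrier_mat n n" "P \<in> carrier_mat n n" "Q \<in> carrier_mat n n"
    and PQ: "P * Q = 1\<^sub>m n" "Q * P = 1\<^sub>m n" and A: "A = P * B * Q" by auto
  have "A * A = P * (B * (Q * P) * B) * Q"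
    unfolding A using carr by (simp add: assoc_mult_mat[of _ n n _ n _ n])
  then have "A * A = P * (B * B) * Q" using PQ carr by simp
  then have "similar_mat_wit (A * A) (B * B) P Q"
    using carr PQ by (intro similar_mat_witI[of _ _ n]) auto
  then show ?thesis unfolding similar_mat_def by blast
qed

text \<open>For \<open>j \<noteq> i\<close>, one of the entries at \<open>(i, j)\<close> and
  \<open>(j, i)\<close> lies below the diagonal, so only \<open>j = i\<close> survives in the
  product.\<close>

lemma upper_triangular_square_diag:
  fixes B :: "'a :: comm_semiring_1 mat"
  assumes B: "B \<in> carrier_mat n n" and tri: "upper_triangular B" and i: "i < n"
  shows "(B * B) $$ (i, i) = (B $$ (i, i))\<^sup>2"
proof -
  have "(B * B) $$ (i, i) = (\<Sum>j<n. B $$ (i, j) * B $$ (j, i))"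
    using B i by (simp add: scalar_prod_def atLeast0LessThan)
  also have "\<dots> = (\<Sum>j<n. if j = i then (B $$ (i, i))\<^sup>2 else 0)"
  proof (rule sum.cong[OF refl])
    fix j assume "j \<in> {..<n}"
    then have "j < i \<Longrightarrow> B $$ (i, j) = 0" "i < j \<Longrightarrow> B $$ (j, i) = 0"
      using tri B i by auto
    then show "B $$ (i, j) * B $$ (j, i) = (if j = i then (B $$ (i, i))\<^sup>2 else 0)"
      by (cases j i rule: linorder_cases) (auto simp: power2_eq_square)
  qed
  finally show ?thesis using i by simp
qed

lemma proots_prod_linear: "proots (\<Prod>a\<leftarrow>es. [:- a, 1 :: 'a :: field:]) = mset es"
proof -
  have "0 \<notin> set (map (\<lambda>a. [:- a, 1 :: 'a:]) es)" by auto
  from proots_prod_list[OF this] show ?thesis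
    by (induction es) (simp_all add: o_def)
qed

text \<open>Schur triangularization over the complex numbers: the diagonal of the triangular form
  lists the roots with algebraic multiplicity, and similarity preserves the traces of the matrix and
  of its square.\<close>

lemma char_poly_roots_power_sums:
  fixes A :: "complex mat"
  assumes A: "A \<in> carrier_mat n n"
  obtains es where "proots (char_poly A) = mset es" "length es = n"
    "(\<Sum>i<n. es ! i) = mat_trace A" "(\<Sum>i<n. (es ! i)\<^sup>2) = mat_trace (A * A)"
proof -
  from char_poly_factorized[OF A] obtain as where
    cp: "char_poly A = (\<Prod>a\<leftarrow>as. [:- a, 1:])" by blast
  from schur_decomposition_exists[OF A cp] obtain B where
    B: "B \<in> carrier_mat n n" "upper_triangular B" "similar_mat A B" by blast
  let ?es = "diag_mat B"
  have "proots (char_poly A) = mset ?es"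
    using char_poly_similar[OF B(3)] char_poly_upper_triangular[OF B(1,2)]
    by (simp add: proots_prod_linear)
  moreover have "length ?es = n" using B(1) by (simp add: diag_mat_def)
  moreover have "(\<Sum>i<n. ?es ! i) = mat_trace A"
    using B(1) mat_trace_similar[OF B(3)] by (simp add: diag_mat_def mat_trace_def)
  \<comment> \<open>The simp rule for entries of a product is disabled so that the diagonal of
    \<open>B * B\<close> stays visible to the previous lemma.\<close>
  moreover have "(\<Sum>i<n. (?es ! i)\<^sup>2) = mat_trace (B * B)"
    using B(1) upper_triangular_square_diag[OF B(1,2)]
    by (simp add: mat_trace_def diag_mat_def del: index_mult_mat(1))
  ultimately show ?thesis
    using that mat_trace_similar[OF similar_mat_square[OF B(3)]] by simp
qed

text \<open>The Hermitian form of an eigenvector \<open>x\<close> equals \<open>k\<close> times the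
  squared norm of \<open>x\<close>. The form is its own conjugate and the norm is nonzero, so
  \<open>k\<close> is real.\<close>

lemma eigenvalue_symmetric_real:
  fixes A :: "real mat"
  assumes A: "A \<in> carrier_mat n n"
    and sym: "\<And>i j. i < n \<Longrightarrow> j < n \<Longrightarrow> A $$ (i, j) = A $$ (j, i)"
    and ev: "eigenvalue (map_mat complex_of_real A) k"
  shows "k \<in> \<real>"
proof -
  from ev obtain x where x: "x \<in> carrier_vec n" "x \<noteq> 0\<^sub>v n"
    and eq: "map_mat complex_of_real A *\<^sub>v x = k \<cdot>\<^sub>v x"
    using A unfolding eigenvalue_def eigenvector_def by auto
  have row: "(\<Sum>j<n. complex_of_real (A $$ (i, j)) * x $ j) = k * x $ i" if i: "i < n" for i
  proof -
    have "(map_mat complex_of_real A *\<^sub>v x) $ i = (k \<cdot>\<^sub>v x) $ i" using eq by simp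
    then show ?thesis using A x i by (simp add: scalar_prod_def atLeast0LessThan)
  qed
  define q where "q = (\<Sum>i<n. \<Sum>j<n. complex_of_real (A $$ (i, j)) * x $ j * cnj (x $ i))"
  define s where "s = (\<Sum>i<n. (cmod (x $ i))\<^sup>2)"
  have "q = (\<Sum>i<n. k * (x $ i * cnj (x $ i)))"
    unfolding q_def by (intro sum.cong refl) (simp flip: sum_distrib_right add: row)
  then have q: "q = k * complex_of_real s"
    by (simp add: s_def complex_norm_square sum_distrib_left del: of_real_power)
  \<comment> \<open>Conjugation fixes the real entries; after using symmetry, this is
    \<open>q\<close> with the two indices exchanged.\<close>
  have "cnj q = (\<Sum>i<n. \<Sum>j<n. complex_of_real (A $$ (j, i)) * x $ i * cnj (x $ j))"
    unfolding q_def cnj_sum by (intro sum.cong refl) (simp add: sym)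
  also have "\<dots> = q" unfolding q_def by (rule sum.swap)
  finally have "cnj k * complex_of_real s = k * complex_of_real s" by (simp add: q)
  moreover have "s \<noteq> 0"
  proof
    assume "s = 0"
    then have "\<forall>i<n. x $ i = 0" unfolding s_def by (subst (asm) sum_nonneg_eq_0_iff) auto
    then show False using x by auto
  qed
  ultimately show ?thesis by (simp add: Reals_cnj_iff)
qed

text \<open>The center is the mean of the eigenvalues, so the bound is Cauchy-Schwarz plus a
  variance computation. Symmetry turns the trace of the square into the sum of squared entries,
  which is easy to read off for a graph matrix.\<close>

lemma symmetric_mat_energy_le:
  fixes A :: "real mat"
  assumes A: "A \<in> carrier_mat n n"
    and sym: "\<And>i j. i < n \<Longrightarrow> j < n \<Longrightarrow> A $$ (i, j) = A $$ (j, i)"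
  shows "(\<Sum>\<mu>\<in>#eigenvalues_mset A. cmod (\<mu> - complex_of_real (mat_trace A / real n)))
    \<le> sqrt (real n * (\<Sum>i<n. \<Sum>j<n. (A $$ (i, j))\<^sup>2) - (mat_trace A)\<^sup>2)"
proof -
  let ?C = "map_mat complex_of_real A"
  let ?c = "mat_trace A / real n"
  have C: "?C \<in> carrier_mat n n" using A by simp
  from char_poly_roots_power_sums[OF C] obtain es where
    es: "proots (char_poly ?C) = mset es" "length es = n"
    and p: "(\<Sum>i<n. es ! i) = mat_trace ?C" "(\<Sum>i<n. (es ! i)\<^sup>2) = mat_trace (?C * ?C)" .
  define r where "r i = Re (es ! i)" for i
  have real: "es ! i = complex_of_real (r i)" if "i < n" for i
  proof -
    have "es ! i \<in># proots (char_poly ?C)" using es that by simp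
    \<comment> \<open>The members of \<open>proots\<close> are the zeros only for a nonzero
      polynomial; for the zero polynomial the goal is trivial.\<close>
    then have "poly (char_poly ?C) (es ! i) = 0"
      by (cases "char_poly ?C = 0") auto
    then have "eigenvalue ?C (es ! i)" using eigenvalue_root_char_poly[OF C] by simp
    from eigenvalue_symmetric_real[OF A sym this] show ?thesis by (simp add: r_def)
  qed
  have "complex_of_real (\<Sum>i<n. r i) = complex_of_real (mat_trace A)"
    using p(1) A by (simp add: real mat_trace_def)
  then have r1: "(\<Sum>i<n. r i) = mat_trace A" by (simp only: of_real_eq_iff)
  have "complex_of_real (\<Sum>i<n. (r i)\<^sup>2) = complex_of_real (\<Sum>i<n. \<Sum>j<n. (A $$ (i, j))\<^sup>2)"
    using p(2) A by (simp add: real mat_trace_mult[OF C C] sym power2_eq_square)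
  then have r2: "(\<Sum>i<n. (r i)\<^sup>2) = (\<Sum>i<n. \<Sum>j<n. (A $$ (i, j))\<^sup>2)" by (simp only: of_real_eq_iff)
  have "(\<Sum>\<mu>\<in>#eigenvalues_mset A. cmod (\<mu> - complex_of_real ?c)) = (\<Sum>i<n. cmod (es ! i - complex_of_real ?c))"
    unfolding eigenvalues_mset_def es(1)
    using sum_mset_sum_list[of "map (\<lambda>\<mu>. cmod (\<mu> - complex_of_real ?c)) es"] es(2)
    by (simp add: sum_list_sum_nth atLeast0LessThan)
  also have "\<dots> = (\<Sum>i<n. \<bar>r i - ?c\<bar>)"
    by (intro sum.cong refl) (simp only: lessThan_iff real norm_of_real flip: of_real_diff)
  also have "\<dots> \<le> sqrt (real n * (\<Sum>i<n. (r i - ?c)\<^sup>2))"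
  proof (rule real_le_rsqrt)
    \<comment> \<open>Cauchy-Schwarz against the all-ones vector.\<close>
    show "(\<Sum>i<n. \<bar>r i - ?c\<bar>)\<^sup>2 \<le> real n * (\<Sum>i<n. (r i - ?c)\<^sup>2)"
      using sum_squared_le_sum_of_squares[of "\<lambda>i. \<bar>r i - ?c\<bar>" "{..<n}"] by (simp add: mult.commute)
  qed
  also have "real n * (\<Sum>i<n. (r i - ?c)\<^sup>2) = real n * (\<Sum>i<n. (r i)\<^sup>2) - (mat_trace A)\<^sup>2"
  \<comment> \<open>For \<open>n = 0\<close> both sides vanish. Otherwise \<open>n * ?c\<close> is
    the trace, and the cross term and the constant term combine to minus its square.\<close>
  proof (cases "n = 0")
    case True
    then show ?thesis using A by (simp add: mat_trace_def)
  next
    case False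
    have "(\<Sum>i<n. (r i - ?c)\<^sup>2) = (\<Sum>i<n. (r i)\<^sup>2 - 2 * ?c * r i + ?c\<^sup>2)"
      by (intro sum.cong refl) (simp add: power2_diff)
    also have "\<dots> = (\<Sum>i<n. (r i)\<^sup>2) - 2 * ?c * mat_trace A + real n * ?c\<^sup>2"
      unfolding r1[symmetric] by (simp add: sum.distrib sum_subtractf sum_distrib_left)
    finally show ?thesis using False by (simp add: field_simps power2_eq_square)
  qed
  finally show ?thesis unfolding r2 .
qed

text \<open>Double counting along the map from ordered to unordered pairs: symmetry puts both
  orientations into each fiber, and the absence of loops makes them distinct.\<close>

lemma (in graph) card_arcs_ends: "card (arcs_ends G) = 2 * card (undirected_edges G)"
proof -
  let ?f = "\<lambda>(u, w). {u, w}"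
  have img: "undirected_edges G = ?f ` arcs_ends G"
    unfolding undirected_edges_def arcs_ends_conv by (auto simp: image_image)
  have fin: "finite (arcs_ends G)" by (simp add: arcs_ends_conv)
  have "card (?f -` {e} \<inter> arcs_ends G) = 2" if "e \<in> undirected_edges G" for e
  proof -
    from that obtain u w where e: "e = {u, w}" and uw: "(u, w) \<in> arcs_ends G" 
      unfolding img by auto
    have "u \<noteq> w" using uw adj_not_same by blast
    moreover have "(w, u) \<in> arcs_ends G" by (rule arcs_ends_symmetric[OF sym_arcs uw])
    ultimately have "?f -` {e} \<inter> arcs_ends G = {(u, w), (w, u)}"
      using uw by (auto simp: e doubleton_eq_iff)
    then show ?thesis using \<open>u \<noteq> w\<close> by simp
  qed
  then have "(\<Sum>e\<in>undirected_edges G. card (?f -` {e} \<inter> arcs_ends G)) = 2 * card (undirected_edges G)"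
    by simp
  moreover have "card (arcs_ends G) = (\<Sum>e\<in>undirected_edges G. card (?f -` {e} \<inter> arcs_ends G))"
    unfolding img using sum.image_gen[OF fin, of "\<lambda>_. 1 :: nat" ?f]
    by (simp add: vimage_def Int_def conj_commute)
  ultimately show ?thesis by simp
qed

theorem theorem4:
  fixes G :: "('a, 'b) pre_digraph" and v :: "nat \<Rightarrow> 'a" and n m :: nat
  assumes "graph G"
    and "Digraph_Component.connected G"
    and "n = card (verts G)"
    and "m = card (undirected_edges G)"
    and "bij_betw v {..<n} (verts G)"
  shows "eccentricity_laplacian_energy G v
    \<le> sqrt (real n * first_zagreb_eccentricity G - (total_eccentricity G)\<^sup>2 + 2 * real m * real n)"
proof -
  interpret graph G by fact
  note n = assms(3) and bij = assms(5)
  let ?L = "eccentricity_laplacian G v"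
  let ?a = "\<lambda>u w. if u \<rightarrow>\<^bsub>G\<^esub> w then 1 else 0 :: real"
  have L: "?L \<in> carrier_mat n n"
    by (simp add: eccentricity_laplacian_def adjacency_mat_def Let_def minus_carrier_mat n)
  have ent: "?L $$ (i, j) = (if i = j then eccentricity G (v i) else 0) - ?a (v i) (v j)"
    if "i < n" "j < n" for i j
    using that
    by (simp add: eccentricity_laplacian_def adjacency_mat_def eccentricity_diag_mat_def Let_def n)
  have irr: "\<not> u \<rightarrow>\<^bsub>G\<^esub> u" for u by (rule notI) (rule adj_not_same)
  have sym_dom: "u \<rightarrow>\<^bsub>G\<^esub> w \<longleftrightarrow> w \<rightarrow>\<^bsub>G\<^esub> u" for u w
    by (rule iffI) (rule arcs_ends_symmetric[OF sym_arcs], assumption)+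
  have sym: "?L $$ (i, j) = ?L $$ (j, i)" if "i < n" "j < n" for i j
    using that sym_dom[of "v i" "v j"] by (simp add: ent)
  have reindex: "(\<Sum>i<n. f (v i)) = (\<Sum>u\<in>verts G. f u)" for f :: "'a \<Rightarrow> real"
    using sum.reindex_bij_betw[OF bij] .
  have trace: "mat_trace ?L = total_eccentricity G"
    using L by (simp add: mat_trace_def ent irr total_eccentricity_def reindex)
  have sub: "arcs_ends G \<subseteq> verts G \<times> verts G" using adj_in_verts by auto
  \<comment> \<open>No mixed terms arise: without loops, the eccentricity part lives on the diagonal
    and the adjacency part off it, where an entry -1 squares to 1.\<close>
  have "(\<Sum>i<n. \<Sum>j<n. (?L $$ (i, j))\<^sup>2)
      = (\<Sum>i<n. \<Sum>j<n. (if i = j then (eccentricity G (v i))\<^sup>2 else 0) + ?a (v i) (v j))"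
    by (intro sum.cong refl) (auto simp: ent irr)
  also have "\<dots> = (\<Sum>i<n. (eccentricity G (v i))\<^sup>2) + (\<Sum>i<n. \<Sum>j<n. ?a (v i) (v j))"
    by (simp add: sum.distrib)
  also have "(\<Sum>i<n. (eccentricity G (v i))\<^sup>2) = first_zagreb_eccentricity G"
    unfolding first_zagreb_eccentricity_def by (rule reindex)
  \<comment> \<open>Both indices are transported along the enumeration \<open>v\<close>, leaving the
    indicator of \<open>arcs_ends G\<close> summed over all vertex pairs.\<close>
  also have "(\<Sum>i<n. \<Sum>j<n. ?a (v i) (v j)) = (\<Sum>(u, w)\<in>verts G \<times> verts G. ?a u w)"
    unfolding sum.cartesian_product[symmetric] reindex[symmetric] ..
  also have "\<dots> = real (card (arcs_ends G))"
    using sub by (simp add: case_prod_unfold sum.If_cases Int_absorb1)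
  finally have sq: "(\<Sum>i<n. \<Sum>j<n. (?L $$ (i, j))\<^sup>2) = first_zagreb_eccentricity G + 2 * real m"
    by (simp add: card_arcs_ends assms(4))
  show ?thesis
    using symmetric_mat_energy_le[OF L sym, unfolded trace sq]
    unfolding eccentricity_laplacian_energy_def n[symmetric] by (simp add: algebra_simps)
qed

end
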